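(* Let $S=(\langle a_j,b_j,S_j\rangle)_{j\in J}$ be a continuous t-conorm and $T=(\langle c_i,d_i,T_i\rangle)_{i\in I}$ a continuous t-norm, represented as ordinal sums of continuous Archimedean summands. Let $\Lambda=\{(j,i)\in J\times I : \,]a_j,b_j[\,\cap\,]c_i,d_i[\,\neq\emptyset\}$. For $(j,i)\in\Lambda$ and $x,y\in[0,1]$ let $\widehat S_j(x,y)=S_j(x,y)$ if $(x,y)\in[a_j,b_j]^2$ and $\widehat S_j(x,y)=\max\{x,y\}$ otherwise, and let $\widehat T_i(x,y)=T_i(x,y)$ if $(x,y)\in[c_i,d_i]^2$ and $\widehat T_i(x,y)=\min\{x,y\}$ otherwise. Then $S\gg_w T$ if and only if $\widehat S_j\gg_w\widehat T_i$ for all $(j,i)\in\Lambda$.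
   Context: Open intervals are written $]p,q[$. For $[p,q]\subseteq[0,1]$ with $p<q$, a t-norm (t-conorm) on $[p,q]$ is an associative, commutative map $[p,q]^2\to[p,q]$, nondecreasing in each variable, with neutral element $q$ (respectively $p$); on $[0,1]$ it is simply called a t-norm (t-conorm). A t-conorm $S$ weakly dominates a t-norm $T$ (written $S\gg_w T$) if $S(T(x,y),z)\ge T(S(x,z),y)$ for all $x,y,z\in[0,1]$. A continuous t-norm $T$ on $[c,d]$ is Archimedean if $T(x,x)<x$ for all $x\in\,]c,d[$; a continuous t-conorm $S$ on $[a,b]$ is Archimedean if $S(x,x)>x$ for all $x\in\,]a,b[$. Ordinal sums: for a (possibly empty) family of pairwise disjoint nonempty open intervals $]c_i,d_i[\,\subseteq[0,1]$, $i\in I$, and continuous Archimedean t-norms $T_i$ on $[c_i,d_i]$, $T=(\langle c_i,d_i,T_i\rangle)_{i\in I}$ is the t-norm with $T(x,y)=T_i(x,y)$ if $(x,y)\in[c_i,d_i]^2$ for some $i$, and $T(x,y)=\min\{x,y\}$ otherwise. Similarly, for pairwise disjoint nonempty open intervals $]a_j,b_j[\,\subseteq[0,1]$, $j\in J$, and continuous Archimedean t-conorms $S_j$ on $[a_j,b_j]$, $S=(\langle a_j,b_j,S_j\rangle)_{j\in J}$ is the t-conorm with $S(x,y)=S_j(x,y)$ if $(x,y)\in[a_j,b_j]^2$ for some $j$, and $S(x,y)=\max\{x,y\}$ otherwise. *)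

theory Defs
  imports Complex_Main "HOL-Library.Disjoint_Sets"
begin

text \<open>
  A binary operation on \<open>[p,q]\<close> is a total function \<open>real \<Rightarrow> real \<Rightarrow> real\<close> of which only the
  values on \<open>[p,q]\<^sup>2\<close> matter.
\<close>

definition tnorm_on :: "real \<Rightarrow> real \<Rightarrow> (real \<Rightarrow> real \<Rightarrow> real) \<Rightarrow> bool" where
  "tnorm_on p q T \<longleftrightarrow>
     (\<forall>x\<in>{p..q}. \<forall>y\<in>{p..q}. T x y \<in> {p..q}) \<and>
     (\<forall>x\<in>{p..q}. \<forall>y\<in>{p..q}. \<forall>z\<in>{p..q}. T (T x y) z = T x (T y z)) \<and>
     (\<forall>x\<in>{p..q}. \<forall>y\<in>{p..q}. T x y = T y x) \<and>
     (\<forall>x\<in>{p..q}. mono_on {p..q} (\<lambda>y. T x y)) \<and>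
     (\<forall>y\<in>{p..q}. mono_on {p..q} (\<lambda>x. T x y)) \<and>
     (\<forall>x\<in>{p..q}. T x q = x \<and> T q x = x)"

definition tconorm_on :: "real \<Rightarrow> real \<Rightarrow> (real \<Rightarrow> real \<Rightarrow> real) \<Rightarrow> bool" where
  "tconorm_on p q S \<longleftrightarrow>
     (\<forall>x\<in>{p..q}. \<forall>y\<in>{p..q}. S x y \<in> {p..q}) \<and>
     (\<forall>x\<in>{p..q}. \<forall>y\<in>{p..q}. \<forall>z\<in>{p..q}. S (S x y) z = S x (S y z)) \<and>
     (\<forall>x\<in>{p..q}. \<forall>y\<in>{p..q}. S x y = S y x) \<and>
     (\<forall>x\<in>{p..q}. mono_on {p..q} (\<lambda>y. S x y)) \<and>
     (\<forall>y\<in>{p..q}. mono_on {p..q} (\<lambda>x. S x y)) \<and>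
     (\<forall>x\<in>{p..q}. S x p = x \<and> S p x = x)"

definition continuous_binop_on :: "real \<Rightarrow> real \<Rightarrow> (real \<Rightarrow> real \<Rightarrow> real) \<Rightarrow> bool" where
  "continuous_binop_on p q F \<longleftrightarrow> continuous_on ({p..q} \<times> {p..q}) (\<lambda>(x, y). F x y)"

definition cont_arch_tnorm_on :: "real \<Rightarrow> real \<Rightarrow> (real \<Rightarrow> real \<Rightarrow> real) \<Rightarrow> bool" where
  "cont_arch_tnorm_on c d T \<longleftrightarrow>
     tnorm_on c d T \<and> continuous_binop_on c d T \<and> (\<forall>x\<in>{c<..<d}. T x x < x)"

definition cont_arch_tconorm_on :: "real \<Rightarrow> real \<Rightarrow> (real \<Rightarrow> real \<Rightarrow> real) \<Rightarrow> bool" where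
  "cont_arch_tconorm_on a b S \<longleftrightarrow>
     tconorm_on a b S \<and> continuous_binop_on a b S \<and> (\<forall>x\<in>{a<..<b}. S x x > x)"

definition weakly_dominates ::
    "(real \<Rightarrow> real \<Rightarrow> real) \<Rightarrow> (real \<Rightarrow> real \<Rightarrow> real) \<Rightarrow> bool"  (infix "\<ggreater>\<^sub>w" 50) where
  "S \<ggreater>\<^sub>w T \<longleftrightarrow>
     (\<forall>x\<in>{0..1}. \<forall>y\<in>{0..1}. \<forall>z\<in>{0..1}. S (T x y) z \<ge> T (S x z) y)"

definition disjoint_intervals :: "'i set \<Rightarrow> ('i \<Rightarrow> real) \<Rightarrow> ('i \<Rightarrow> real) \<Rightarrow> bool" where
  "disjoint_intervals I c d \<longleftrightarrow>
     (\<forall>i\<in>I. 0 \<le> c i \<and> c i < d i \<and> d i \<le> 1) \<and>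
     disjoint_family_on (\<lambda>i. {c i<..<d i}) I"

text \<open>
  Ordinal sums are given by a relation stating the values of the sum on \<open>[0,1]\<^sup>2\<close>.  Two of the
  closed squares can only share a corner \<open>(e,e)\<close>, where both summands have the value \<open>e\<close>
  (neutral element of the one, annihilator of the other), so the clauses are consistent.
\<close>

definition tnorm_ordinal_sum ::
    "'i set \<Rightarrow> ('i \<Rightarrow> real) \<Rightarrow> ('i \<Rightarrow> real) \<Rightarrow> ('i \<Rightarrow> real \<Rightarrow> real \<Rightarrow> real) \<Rightarrow>
     (real \<Rightarrow> real \<Rightarrow> real) \<Rightarrow> bool" where
  "tnorm_ordinal_sum I c d Ti T \<longleftrightarrow>
     disjoint_intervals I c d \<and>
     (\<forall>i\<in>I. cont_arch_tnorm_on (c i) (d i) (Ti i)) \<and>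
     (\<forall>i\<in>I. \<forall>x\<in>{c i..d i}. \<forall>y\<in>{c i..d i}. T x y = Ti i x y) \<and>
     (\<forall>x\<in>{0..1}. \<forall>y\<in>{0..1}.
        \<not> (\<exists>i\<in>I. x \<in> {c i..d i} \<and> y \<in> {c i..d i}) \<longrightarrow> T x y = min x y)"

definition tconorm_ordinal_sum ::
    "'j set \<Rightarrow> ('j \<Rightarrow> real) \<Rightarrow> ('j \<Rightarrow> real) \<Rightarrow> ('j \<Rightarrow> real \<Rightarrow> real \<Rightarrow> real) \<Rightarrow>
     (real \<Rightarrow> real \<Rightarrow> real) \<Rightarrow> bool" where
  "tconorm_ordinal_sum J a b Sj S \<longleftrightarrow>
     disjoint_intervals J a b \<and>
     (\<forall>j\<in>J. cont_arch_tconorm_on (a j) (b j) (Sj j)) \<and>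
     (\<forall>j\<in>J. \<forall>x\<in>{a j..b j}. \<forall>y\<in>{a j..b j}. S x y = Sj j x y) \<and>
     (\<forall>x\<in>{0..1}. \<forall>y\<in>{0..1}.
        \<not> (\<exists>j\<in>J. x \<in> {a j..b j} \<and> y \<in> {a j..b j}) \<longrightarrow> S x y = max x y)"

definition extend_by_min ::
    "real \<Rightarrow> real \<Rightarrow> (real \<Rightarrow> real \<Rightarrow> real) \<Rightarrow> real \<Rightarrow> real \<Rightarrow> real" where
  "extend_by_min c d T x y = (if x \<in> {c..d} \<and> y \<in> {c..d} then T x y else min x y)"

definition extend_by_max ::
    "real \<Rightarrow> real \<Rightarrow> (real \<Rightarrow> real \<Rightarrow> real) \<Rightarrow> real \<Rightarrow> real \<Rightarrow> real" where
  "extend_by_max a b S x y = (if x \<in> {a..b} \<and> y \<in> {a..b} then S x y else max x y)"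

end

(*
  The inequality at (x, y, z) is automatic as soon as S x z = max x z or T x y = min x y: only
  max \<le> S and T \<le> min are used.  What remains are triples where x, z lie in the closed interval of
  a summand of S and x, y in that of a summand of T.  There the two summands determine both sides, since
  max and min take over when T x y leaves [a, b] to the left or S x z leaves [c, d] to the right.
  If the open intervals are disjoint, x is an endpoint, which puts us back in the automatic case.
*)
theory Submission
  imports Defs
begin

lemma tnorm_on_closed:
  "tnorm_on p q T \<Longrightarrow> x \<in> {p..q} \<Longrightarrow> y \<in> {p..q} \<Longrightarrow> T x y \<in> {p..q}"
  unfolding tnorm_on_def by blast

lemma tnorm_on_le_min:
  assumes T: "tnorm_on p q T" and x: "x \<in> {p..q}" and y: "y \<in> {p..q}"
  shows "T x y \<le> min x y"
proof -
  have q: "q \<in> {p..q}" using x by auto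
  have "T x y \<le> T x q"
    using mono_onD[of "{p..q}" "T x" y q] T x y q unfolding tnorm_on_def by simp
  moreover have "T x y \<le> T q y"
    using mono_onD[of "{p..q}" "\<lambda>x. T x y" x q] T x y q unfolding tnorm_on_def by simp
  ultimately show ?thesis using T x y unfolding tnorm_on_def by simp
qed

lemma tconorm_on_closed:
  "tconorm_on p q S \<Longrightarrow> x \<in> {p..q} \<Longrightarrow> y \<in> {p..q} \<Longrightarrow> S x y \<in> {p..q}"
  unfolding tconorm_on_def by blast

lemma tconorm_on_ge_max:
  assumes S: "tconorm_on p q S" and x: "x \<in> {p..q}" and y: "y \<in> {p..q}"
  shows "max x y \<le> S x y"
proof -
  have p: "p \<in> {p..q}" using x by auto
  have "S x p \<le> S x y"
    using mono_onD[of "{p..q}" "S x" p y] S x y p unfolding tconorm_on_def by simp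
  moreover have "S p y \<le> S x y"
    using mono_onD[of "{p..q}" "\<lambda>x. S x y" p x] S x y p unfolding tconorm_on_def by simp
  ultimately show ?thesis using S x y unfolding tconorm_on_def by simp
qed

lemma extend_by_max_bounds:
  assumes "tconorm_on a b S" "0 \<le> a" "b \<le> 1" "x \<in> {0..1}" "y \<in> {0..1}"
  shows "extend_by_max a b S x y \<in> {max x y..1}"
  using assms tconorm_on_closed[OF assms(1), of x y] tconorm_on_ge_max[OF assms(1), of x y]
  unfolding extend_by_max_def by auto

lemma extend_by_min_bounds:
  assumes "tnorm_on c d T" "0 \<le> c" "d \<le> 1" "x \<in> {0..1}" "y \<in> {0..1}"
  shows "extend_by_min c d T x y \<in> {0..min x y}"
  using assms tnorm_on_closed[OF assms(1), of x y] tnorm_on_le_min[OF assms(1), of x y]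
  unfolding extend_by_min_def by auto

text \<open>If \<open>S x z = max x z\<close>, the left side is \<open>T x y\<close> or
  \<open>T z y\<close>; the first is at most \<open>S (T x y) z\<close> directly, the second through
  \<open>T z y\<close> \<le> \<open>z\<close>. Dually, if \<open>T x y = min x y\<close>, the right
  side is \<open>S x z\<close> or \<open>S y z\<close>, and \<open>T (S x z) y\<close> is at most
  both \<open>S x z\<close> and \<open>y\<close> \<le> \<open>S y z\<close>. Stated through bounds,
  the lemma applies both to the ordinal sums and to the extended summands.\<close>

lemma weak_domination_ineq_if_max_or_min:
  fixes S T :: "real \<Rightarrow> real \<Rightarrow> real"
  assumes S: "\<And>u v. u \<in> {0..1} \<Longrightarrow> v \<in> {0..1} \<Longrightarrow> S u v \<in> {max u v..1}"
    and T: "\<And>u v. u \<in> {0..1} \<Longrightarrow> v \<in> {0..1} \<Longrightarrow> T u v \<in> {0..min u v}"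
    and x: "x \<in> {0..1}" and y: "y \<in> {0..1}" and z: "z \<in> {0..1}"
    and triv: "S x z = max x z \<or> T x y = min x y"
  shows "T (S x z) y \<le> S (T x y) z"
proof -
  have Sxz: "S x z \<in> {0..1}" and Txy: "T x y \<in> {0..1}"
    using S[OF x z] T[OF x y] x y z by auto
  show ?thesis
    using triv S[OF Txy z] S[OF y z] T[OF Sxz y] T[OF z y]
    by (auto simp: max_def min_def split: if_splits)
qed

text \<open>The argument \<open>t\<close> may lie below \<open>a\<close> because it will be
  \<open>T x y\<close>, which can leave the interval on that side. There monotonicity and the
  neutral element \<open>a\<close> of \<open>Sj\<close> squeeze the value: \<open>z\<close> \<le>
  \<open>S t z\<close> \<le> \<open>S a z\<close> = \<open>z\<close>, which is also
  \<open>max t z\<close>.\<close>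

lemma tconorm_eq_extend_by_max:
  assumes S: "tconorm_on 0 1 S"
    and Sj: "tconorm_on a b Sj" and eq: "\<forall>u\<in>{a..b}. \<forall>v\<in>{a..b}. S u v = Sj u v"
    and ab: "0 \<le> a" "b \<le> 1" and z: "z \<in> {a..b}" and t: "0 \<le> t" "t \<le> b"
  shows "S t z = extend_by_max a b Sj t z"
proof (cases "t \<in> {a..b}")
  case True
  then show ?thesis using eq z by (simp add: extend_by_max_def)
next
  case False
  have "S t z \<le> S a z"
    using S False t z ab unfolding tconorm_on_def by (auto intro!: mono_onD[where f = "\<lambda>x. S x z"])
  also have "\<dots> = z" using Sj eq z unfolding tconorm_on_def by auto
  finally show ?thesis
    using tconorm_on_ge_max[OF S, of t z] False t z ab by (auto simp: extend_by_max_def)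
qed

text \<open>Dual squeeze for \<open>s\<close> above \<open>d\<close>, the side on which
  \<open>S x z\<close> can leave the interval: \<open>y\<close> = \<open>T d y\<close> \<le>
  \<open>T s y\<close> \<le> \<open>y\<close>, with \<open>d\<close> neutral for
  \<open>Ti\<close>.\<close>

lemma tnorm_eq_extend_by_min:
  assumes T: "tnorm_on 0 1 T"
    and Ti: "tnorm_on c d Ti" and eq: "\<forall>u\<in>{c..d}. \<forall>v\<in>{c..d}. T u v = Ti u v"
    and cd: "0 \<le> c" "d \<le> 1" and y: "y \<in> {c..d}" and s: "c \<le> s" "s \<le> 1"
  shows "T s y = extend_by_min c d Ti s y"
proof (cases "s \<in> {c..d}")
  case True
  then show ?thesis using eq y by (simp add: extend_by_min_def)
next
  case False
  have "y = T d y" using Ti eq y unfolding tnorm_on_def by auto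
  also have "T d y \<le> T s y"
    using T False s y cd unfolding tnorm_on_def by (auto intro!: mono_onD[where f = "\<lambda>x. T x y"])
  finally show ?thesis
    using tnorm_on_le_min[OF T, of s y] False s y cd by (auto simp: extend_by_min_def)
qed

lemma weak_domination_sides_eq_extensions:
  assumes S: "tconorm_on 0 1 S" and T: "tnorm_on 0 1 T"
    and Sj: "tconorm_on a b Sj" "\<forall>u\<in>{a..b}. \<forall>v\<in>{a..b}. S u v = Sj u v" "0 \<le> a" "b \<le> 1"
    and Ti: "tnorm_on c d Ti" "\<forall>u\<in>{c..d}. \<forall>v\<in>{c..d}. T u v = Ti u v" "0 \<le> c" "d \<le> 1"
    and xz: "x \<in> {a..b}" "z \<in> {a..b}" and xy: "x \<in> {c..d}" "y \<in> {c..d}"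
  shows "S (T x y) z = extend_by_max a b Sj (extend_by_min c d Ti x y) z" (is ?L)
    and "T (S x z) y = extend_by_min c d Ti (extend_by_max a b Sj x z) y" (is ?R)
proof -
  have unit: "x \<in> {0..1}" "y \<in> {0..1}" "z \<in> {0..1}"
    using xz xy Sj(3,4) Ti(3,4) by auto
  \<comment> \<open>Only the outer operations need the squeeze: the inner arguments lie in the
    squares of the summands. The range conditions hold since \<open>T x y\<close> \<le>
    \<open>x\<close> \<le> \<open>b\<close> and \<open>c\<close> \<le> \<open>x\<close> \<le>
    \<open>S x z\<close>.\<close>
  have "S (T x y) z = extend_by_max a b Sj (T x y) z"
    using tnorm_on_closed[OF T unit(1,2)] tnorm_on_le_min[OF T unit(1,2)] xz
    by (intro tconorm_eq_extend_by_max[OF S Sj]) auto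
  moreover have "T (S x z) y = extend_by_min c d Ti (S x z) y"
    using tconorm_on_closed[OF S unit(1,3)] tconorm_on_ge_max[OF S unit(1,3)] xy
    by (intro tnorm_eq_extend_by_min[OF T Ti]) auto
  ultimately show ?L ?R
    using Sj(2) Ti(2) xz xy by (simp_all add: extend_by_max_def extend_by_min_def)
qed

theorem theorem3p9:
  fixes S T :: "real \<Rightarrow> real \<Rightarrow> real"
    and J :: "'j set" and a b :: "'j \<Rightarrow> real" and Sj :: "'j \<Rightarrow> real \<Rightarrow> real \<Rightarrow> real"
    and I :: "'i set" and c d :: "'i \<Rightarrow> real" and Ti :: "'i \<Rightarrow> real \<Rightarrow> real \<Rightarrow> real"
    and \<Lambda> :: "('j \<times> 'i) set"
  assumes "tconorm_on 0 1 S" and "continuous_binop_on 0 1 S"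
    and "tnorm_on 0 1 T" and "continuous_binop_on 0 1 T"
    and "tconorm_ordinal_sum J a b Sj S"
    and "tnorm_ordinal_sum I c d Ti T"
    and "\<Lambda> = {(j, i) \<in> J \<times> I. {a j<..<b j} \<inter> {c i<..<d i} \<noteq> {}}"
  shows "S \<ggreater>\<^sub>w T \<longleftrightarrow>
    (\<forall>(j, i)\<in>\<Lambda>. extend_by_max (a j) (b j) (Sj j) \<ggreater>\<^sub>w extend_by_min (c i) (d i) (Ti i))"
proof -
  have J: "tconorm_on (a j) (b j) (Sj j)" "\<forall>u\<in>{a j..b j}. \<forall>v\<in>{a j..b j}. S u v = Sj j u v"
    "0 \<le> a j" "b j \<le> 1" if "j \<in> J" for j
    using assms(5) that
    unfolding tconorm_ordinal_sum_def disjoint_intervals_def cont_arch_tconorm_on_def by auto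
  have I: "tnorm_on (c i) (d i) (Ti i)" "\<forall>u\<in>{c i..d i}. \<forall>v\<in>{c i..d i}. T u v = Ti i u v"
    "0 \<le> c i" "d i \<le> 1" if "i \<in> I" for i
    using assms(6) that
    unfolding tnorm_ordinal_sum_def disjoint_intervals_def cont_arch_tnorm_on_def by auto
  note sides = weak_domination_sides_eq_extensions[OF assms(1,3) J I]
  show ?thesis
  proof
    assume dom: "S \<ggreater>\<^sub>w T"
    have "extend_by_max (a j) (b j) (Sj j) \<ggreater>\<^sub>w extend_by_min (c i) (d i) (Ti i)"
      if j: "j \<in> J" and i: "i \<in> I" for j i
      unfolding weakly_dominates_def
    proof (intro ballI)
      fix x y z :: real assume x: "x \<in> {0..1}" and y: "y \<in> {0..1}" and z: "z \<in> {0..1}"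
      let ?S = "extend_by_max (a j) (b j) (Sj j)" and ?T = "extend_by_min (c i) (d i) (Ti i)"
      show "?T (?S x z) y \<le> ?S (?T x y) z"
      proof (cases "(x \<in> {a j..b j} \<and> z \<in> {a j..b j}) \<and> x \<in> {c i..d i} \<and> y \<in> {c i..d i}")
        case True
        moreover have "T (S x z) y \<le> S (T x y) z"
          using dom x y z unfolding weakly_dominates_def by blast
        ultimately show ?thesis using sides[OF j j j j i i i i, of x z y] by simp
      next
        case False
        \<comment> \<open>Outside at least one of the two squares, the corresponding extension takes
          its default value.\<close>
        then have triv: "?S x z = max x z \<or> ?T x y = min x y"
          unfolding extend_by_max_def extend_by_min_def by auto
        have bounds: "?S u v \<in> {max u v..1}" "?T u v \<in> {0..min u v}"
          if "u \<in> {0..1}" "v \<in> {0..1}" for u v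
          using extend_by_max_bounds[OF J(1,3,4)[OF j] that]
            extend_by_min_bounds[OF I(1,3,4)[OF i] that] .
        show ?thesis
          by (rule weak_domination_ineq_if_max_or_min[OF bounds x y z triv])
      qed
    qed
    then show "\<forall>(j, i)\<in>\<Lambda>. extend_by_max (a j) (b j) (Sj j) \<ggreater>\<^sub>w extend_by_min (c i) (d i) (Ti i)"
      using assms(7) by auto
  next
    assume dom: "\<forall>(j, i)\<in>\<Lambda>.
      extend_by_max (a j) (b j) (Sj j) \<ggreater>\<^sub>w extend_by_min (c i) (d i) (Ti i)"
    show "S \<ggreater>\<^sub>w T"
      unfolding weakly_dominates_def
    proof (intro ballI)
      fix x y z :: real assume x: "x \<in> {0..1}" and y: "y \<in> {0..1}" and z: "z \<in> {0..1}"
      show "T (S x z) y \<le> S (T x y) z"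
      proof (cases "S x z = max x z \<or> T x y = min x y")
        case True
        have bounds: "S u v \<in> {max u v..1}" "T u v \<in> {0..min u v}"
          if "u \<in> {0..1}" "v \<in> {0..1}" for u v
          using that tconorm_on_closed[OF assms(1) that] tconorm_on_ge_max[OF assms(1) that]
            tnorm_on_closed[OF assms(3) that] tnorm_on_le_min[OF assms(3) that] by auto
        show ?thesis
          by (rule weak_domination_ineq_if_max_or_min[OF bounds x y z True])
      next
        case False
        obtain j where j: "j \<in> J" and xz: "x \<in> {a j..b j}" "z \<in> {a j..b j}"
          using False assms(5) x z unfolding tconorm_ordinal_sum_def by blast
        obtain i where i: "i \<in> I" and xy: "x \<in> {c i..d i}" "y \<in> {c i..d i}"
          using False assms(6) x y unfolding tnorm_ordinal_sum_def by blast
        \<comment> \<open>At \<open>a j\<close>, the neutral element of \<open>Sj j\<close>,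
          \<open>S x z\<close> would be \<open>z\<close>, hence \<open>max x z\<close>.\<close>
        have "x \<noteq> a j"
          using J[OF j] xz False unfolding tconorm_on_def by auto
        \<comment> \<open>The top \<open>b j\<close> is an annihilator: \<open>Sj j x z\<close> lies
          between \<open>max x z\<close> = \<open>b j\<close> and \<open>b j\<close>, so again
          \<open>S x z\<close> would be the maximum.\<close>
        moreover have "x \<noteq> b j"
          using J(2)[OF j] xz False tconorm_on_closed[OF J(1)[OF j] xz]
            tconorm_on_ge_max[OF J(1)[OF j] xz] by auto
        moreover have "c i < d i"
          using assms(6) i unfolding tnorm_ordinal_sum_def disjoint_intervals_def by blast
        \<comment> \<open>The point \<open>x\<close> is interior to the first interval but possibly
          an endpoint of the second. Since the second is nondegenerate, the open intervals still
          meet close to \<open>x\<close>, so the pair belongs to \<Lambda>.\<close>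
        ultimately have "max (a j) (c i) < min (b j) (d i)"
          using xz xy by auto
        then obtain w where "max (a j) (c i) < w" "w < min (b j) (d i)"
          using dense by blast
        then have "(j, i) \<in> \<Lambda>"
          using assms(7) j i by auto
        then have "extend_by_max (a j) (b j) (Sj j) \<ggreater>\<^sub>w extend_by_min (c i) (d i) (Ti i)"
          using dom by blast
        then show ?thesis
          using sides[OF j j j j i i i i xz xy] x y z unfolding weakly_dominates_def by simp
      qed
    qed
  qed
qed

end
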